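(* Let $L_2=\langle a,t \mid a^2,\ [t^{i}at^{-i},t^{j}at^{-j}],\ i,j\in\mathbb{Z}\rangle$. There is a language of geodesic words for $L_2$ with respect to the generating set $\{t,ta\}$ which contains exactly one representative of each element of $L_2$ and which is accepted by a 1-counter automaton.
   Context: $L_2$ is the lamplighter group, i.e. the wreath product $\mathbb{Z}_2\wr\mathbb{Z}$, where $a$ generates $\mathbb{Z}_2$ and $t$ generates $\mathbb{Z}$; in the generating set $\{t,ta\}$ the element $ta$ is treated as a single letter. For a group $G$ with finite generating set $X$, words are finite strings over the alphabet $X\cup X^{-1}$; a word is geodesic if its length equals the word length (with respect to $X$) of the element it represents. For a group $H$ and a finite alphabet $A$, a (non-deterministic) $H$-automaton over $A$ is a finite directed graph with a distinguished start vertex, some distinguished accept vertices, and edges labelled by elements of $(A\cup\{\epsilon\})\times H$, where $\epsilon$ is the empty string. For a path $p$, $w(p)$ is the word obtained by concatenating the first components of its edge labels and $g(p)\in H$ is the product of the second components (the empty path gives the empty word and the identity). The automaton accepts a word $w$ if there is a path $p$ from the start vertex to an accept vertex with $w(p)=w$ and $g(p)=1$ in $H$. A 1-counter automaton is a $\mathbb{Z}$-automaton. *)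

theory Defs
  imports "HOL-Algebra.Elementary_Groups"
begin

section \<open>Group presentations\<close>

text \<open>A letter \<open>(x, True)\<close> stands for the generator \<open>x\<close>, and \<open>(x, False)\<close> for its formal
  inverse. The generators of a presentation are all elements of the type \<open>'x\<close>.\<close>

type_synonym 'x gword = "('x \<times> bool) list"

definition gword_inv :: "'x gword \<Rightarrow> 'x gword" where
  "gword_inv w = rev (map (\<lambda>(x, b). (x, \<not> b)) w)"

definition gword_comm :: "'x gword \<Rightarrow> 'x gword \<Rightarrow> 'x gword" where
  "gword_comm u v = gword_inv u @ gword_inv v @ u @ v"

inductive pres_eq :: "'x gword set \<Rightarrow> 'x gword \<Rightarrow> 'x gword \<Rightarrow> bool" for R where
  refl: "pres_eq R u u"
| sym: "pres_eq R u v \<Longrightarrow> pres_eq R v u"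
| trans: "pres_eq R u v \<Longrightarrow> pres_eq R v w \<Longrightarrow> pres_eq R u w"
| cancel: "pres_eq R (u @ [(x, b), (x, \<not> b)] @ v) (u @ v)"
| relator: "r \<in> R \<Longrightarrow> pres_eq R (u @ r @ v) (u @ v)"

definition pres_class :: "'x gword set \<Rightarrow> 'x gword \<Rightarrow> 'x gword set" where
  "pres_class R w = {v. pres_eq R w v}"

definition presented_group :: "'x gword set \<Rightarrow> 'x gword set monoid" where
  "presented_group R =
     \<lparr>carrier = range (pres_class R),
      monoid.mult = (\<lambda>U V. \<Union>u\<in>U. \<Union>v\<in>V. pres_class R (u @ v)),
      one = pres_class R []\<rparr>"

lemma pres_eq_append_left: "pres_eq R u v \<Longrightarrow> pres_eq R (w @ u) (w @ v)"
proof (induction rule: pres_eq.induct)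
  case (cancel u x b v)
  then show ?case using pres_eq.cancel[of R "w @ u" x b v] by simp
next
  case (relator r u v)
  then show ?case using pres_eq.relator[of r R "w @ u" v] by simp
qed (blast intro: pres_eq.intros)+

lemma pres_eq_append_right: "pres_eq R u v \<Longrightarrow> pres_eq R (u @ w) (v @ w)"
proof (induction rule: pres_eq.induct)
  case (cancel u x b v)
  then show ?case using pres_eq.cancel[of R u x b "v @ w"] by simp
next
  case (relator r u v)
  then show ?case using pres_eq.relator[of r R u "v @ w"] by simp
qed (blast intro: pres_eq.intros)+

lemma pres_class_eq_iff: "pres_class R u = pres_class R v \<longleftrightarrow> pres_eq R u v"
  unfolding pres_class_def by (blast intro: pres_eq.intros)

lemma presented_group_mult:
  "pres_class R u \<otimes>\<^bsub>presented_group R\<^esub> pres_class R v = pres_class R (u @ v)"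
proof -
  have "pres_class R (u' @ v') = pres_class R (u @ v)"
    if "pres_eq R u u'" "pres_eq R v v'" for u' v'
    unfolding pres_class_eq_iff
    using that by (meson pres_eq.sym pres_eq.trans pres_eq_append_left pres_eq_append_right)
  then have "(\<Union>u'\<in>pres_class R u. \<Union>v'\<in>pres_class R v. pres_class R (u' @ v'))
      = (\<Union>u'\<in>pres_class R u. \<Union>v'\<in>pres_class R v. pres_class R (u @ v))"
    by (intro SUP_cong) (simp_all add: pres_class_def)
  also have "\<dots> = pres_class R (u @ v)"
  proof -
    have "pres_class R u \<noteq> {}" "pres_class R v \<noteq> {}"
      by (auto simp: pres_class_def intro: pres_eq.refl)
    then show ?thesis by simp
  qed
  finally show ?thesis
    by (simp add: presented_group_def)
qed

lemma pres_eq_gword_inv: "pres_eq R (gword_inv w @ w) []"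
proof (induction w)
  case Nil
  then show ?case by (simp add: gword_inv_def pres_eq.refl)
next
  case (Cons a w)
  obtain x b where a: "a = (x, b)" by (cases a)
  have "pres_eq R (gword_inv w @ [(x, \<not> b), (x, \<not> \<not> b)] @ w) (gword_inv w @ w)"
    by (rule pres_eq.cancel)
  then show ?case
    using Cons.IH a by (auto simp: gword_inv_def intro: pres_eq.trans)
qed

lemma carrier_presented_group: "carrier (presented_group R) = range (pres_class R)"
  by (simp add: presented_group_def)

lemma one_presented_group: "\<one>\<^bsub>presented_group R\<^esub> = pres_class R []"
  by (simp add: presented_group_def)

lemma group_presented_group: "group (presented_group R)"
proof (rule groupI)
  fix x assume "x \<in> carrier (presented_group R)"
  then obtain w where "x = pres_class R w" by (auto simp: carrier_presented_group)
  then have "pres_class R (gword_inv w) \<otimes>\<^bsub>presented_group R\<^esub> x = \<one>\<^bsub>presented_group R\<^esub>"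
    using pres_eq_gword_inv[of R w]
    by (simp add: presented_group_mult one_presented_group pres_class_eq_iff)
  then show "\<exists>y\<in>carrier (presented_group R). y \<otimes>\<^bsub>presented_group R\<^esub> x = \<one>\<^bsub>presented_group R\<^esub>"
    by (auto simp: carrier_presented_group)
qed (auto simp: carrier_presented_group one_presented_group presented_group_mult)


section \<open>The lamplighter group\<close>

datatype lamp_gen = Ga | Gt

definition lamp_conj :: "int \<Rightarrow> lamp_gen gword" where
  "lamp_conj i = replicate (nat \<bar>i\<bar>) (Gt, 0 \<le> i) @ [(Ga, True)] @ replicate (nat \<bar>i\<bar>) (Gt, i < 0)"

definition lamp_relators :: "lamp_gen gword set" where
  "lamp_relators = {[(Ga, True), (Ga, True)]} \<union> {gword_comm (lamp_conj i) (lamp_conj j) | i j. True}"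

definition L2 :: "lamp_gen gword set monoid" where
  "L2 = presented_group lamp_relators"

definition L2_a :: "lamp_gen gword set" where
  "L2_a = pres_class lamp_relators [(Ga, True)]"

definition L2_t :: "lamp_gen gword set" where
  "L2_t = pres_class lamp_relators [(Gt, True)]"

definition L2_gens :: "lamp_gen gword set set" where
  "L2_gens = {L2_t, L2_t \<otimes>\<^bsub>L2\<^esub> L2_a}"

lemma group_L2: "group L2"
  unfolding L2_def by (rule group_presented_group)


section \<open>Words and geodesics in a group\<close>

definition sym_alphabet :: "('g, 'm) monoid_scheme \<Rightarrow> 'g set \<Rightarrow> 'g set" where
  "sym_alphabet G X = X \<union> (\<lambda>x. inv\<^bsub>G\<^esub> x) ` X"

definition word_value :: "('g, 'm) monoid_scheme \<Rightarrow> 'g list \<Rightarrow> 'g" where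
  "word_value G w = foldr (\<otimes>\<^bsub>G\<^esub>) w \<one>\<^bsub>G\<^esub>"

definition word_length :: "('g, 'm) monoid_scheme \<Rightarrow> 'g set \<Rightarrow> 'g \<Rightarrow> nat" where
  "word_length G X g =
     (LEAST n. \<exists>w \<in> lists (sym_alphabet G X). length w = n \<and> word_value G w = g)"

definition geodesic_word :: "('g, 'm) monoid_scheme \<Rightarrow> 'g set \<Rightarrow> 'g list \<Rightarrow> bool" where
  "geodesic_word G X w \<longleftrightarrow>
     w \<in> lists (sym_alphabet G X) \<and> length w = word_length G X (word_value G w)"


section \<open>Automata over a group\<close>

text \<open>An edge is a tuple (source, letter, group element, target), where the letter \<open>None\<close> is the
  empty string. Parallel edges carrying the same label are identified, which does not
  affect the accepted language.\<close>

type_synonym ('q, 'l, 'h) edge = "'q \<times> 'l option \<times> 'h \<times> 'q"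

record ('q, 'l, 'h) group_automaton =
  vertices :: "'q set"
  start_vertex :: 'q
  accept_vertices :: "'q set"
  edges :: "('q, 'l, 'h) edge set"

definition is_group_automaton ::
    "('h, 'm) monoid_scheme \<Rightarrow> 'l set \<Rightarrow> ('q, 'l, 'h) group_automaton \<Rightarrow> bool" where
  "is_group_automaton H A M \<longleftrightarrow>
     finite (vertices M) \<and> start_vertex M \<in> vertices M \<and> accept_vertices M \<subseteq> vertices M \<and>
     finite (edges M) \<and>
     edges M \<subseteq> vertices M \<times> ({None} \<union> Some ` A) \<times> carrier H \<times> vertices M"

fun is_path ::
    "('q, 'l, 'h) group_automaton \<Rightarrow> 'q \<Rightarrow> ('q, 'l, 'h) edge list \<Rightarrow> 'q \<Rightarrow> bool" where
  "is_path M p [] q \<longleftrightarrow> p = q"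
| "is_path M p (e # es) q \<longleftrightarrow> e \<in> edges M \<and> fst e = p \<and> is_path M (snd (snd (snd e))) es q"

definition path_word :: "('q, 'l, 'h) edge list \<Rightarrow> 'l list" where
  "path_word es = concat (map (\<lambda>(_, l, _, _). case l of None \<Rightarrow> [] | Some x \<Rightarrow> [x]) es)"

definition path_value :: "('h, 'm) monoid_scheme \<Rightarrow> ('q, 'l, 'h) edge list \<Rightarrow> 'h" where
  "path_value H es = word_value H (map (\<lambda>(_, _, h, _). h) es)"

definition accepted_language ::
    "('h, 'm) monoid_scheme \<Rightarrow> ('q, 'l, 'h) group_automaton \<Rightarrow> 'l list set" where
  "accepted_language H M =
     {w. \<exists>q \<in> accept_vertices M. \<exists>es. is_path M (start_vertex M) es q \<and>
           path_word es = w \<and> path_value H es = \<one>\<^bsub>H\<^esub>}"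

text \<open>Every finite graph is isomorphic to one with vertices in \<open>nat\<close>, so restricting the vertex
  type loses no generality.\<close>

definition accepted_by_one_counter :: "'l set \<Rightarrow> 'l list set \<Rightarrow> bool" where
  "accepted_by_one_counter A L \<longleftrightarrow>
     (\<exists>M :: (nat, 'l, int) group_automaton.
        is_group_automaton integer_group A M \<and> accepted_language integer_group M = L)"

end

theory Submission
  imports Defs
begin

text \<open>A word in \<open>t, ta\<close> and their inverses is a path of the lamplighter on \<open>\<int>\<close> in which each
  crossing of an edge may switch the lamp of that edge. A geodesic to an endpoint \<open>n \<ge> 0\<close> first
  runs left by some \<open>k\<close>, then right to \<open>n + j\<close>, then left to \<open>n\<close>, where \<open>k\<close> and \<open>j\<close> are as small as
  the lit lamps allow. All the switching can be done in the middle run, which crosses every edge of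
  the swept interval exactly once. The normal form is then \<open>t\<^sup>-\<^sup>k v t\<^sup>-\<^sup>j\<close> with \<open>v\<close> a word in
  \<open>t, ta\<close> that starts with \<open>ta\<close> if \<open>k > 0\<close>, ends with \<open>ta\<close> if \<open>j > 0\<close>, and satisfies
  \<open>\<bar>v\<bar> \<ge> k + j\<close>. The last condition is a single inequality, so one counter without tests for zero
  suffices, whereas switching on the first visit would require two exact comparisons. Negative
  endpoints are the mirror image.\<close>


section \<open>States of the lamplighter\<close>

type_synonym lamp_state = "int set \<times> int"

definition toggle :: "'i \<Rightarrow> 'i set \<Rightarrow> 'i set" where
  "toggle x S = (if x \<in> S then S - {x} else insert x S)"

lemma toggle_toggle [simp]: "toggle x (toggle x S) = S"
  by (auto simp: toggle_def)

lemma toggle_commute: "toggle x (toggle y S) = toggle y (toggle x S)"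
  by (auto simp: toggle_def)

lemma finite_toggle [simp]: "finite (toggle x S) = finite S"
  by (simp add: toggle_def)

text \<open>A state lists the lit lamps and the position. \<open>fold\<close> reads a word from the
  left, so appending a letter acts at the current position. The sign of \<open>Ga\<close> is ignored
  because \<open>a\<close> is an involution.\<close>

fun gen_act :: "lamp_gen \<times> bool \<Rightarrow> lamp_state \<Rightarrow> lamp_state" where
  "gen_act (Ga, _) (S, n) = (toggle n S, n)"
| "gen_act (Gt, b) (S, n) = (S, if b then n + 1 else n - 1)"

lemma gen_act_cancel [simp]: "gen_act (x, \<not> b) (gen_act (x, b) s) = s"
  by (cases x; cases s) auto

lemma fold_gen_act_gword_inv: "fold gen_act (gword_inv w) (fold gen_act w s) = s"
  by (induction w arbitrary: s) (auto simp: gword_inv_def)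

lemma fold_gen_act_replicate_Gt:
  "fold gen_act (replicate k (Gt, b)) (S, n) = (S, if b then n + int k else n - int k)"
  by (induction k arbitrary: n) auto

lemma fold_gen_act_lamp_conj: "fold gen_act (lamp_conj i) (S, n) = (toggle (n + i) S, n)"
  by (auto simp: lamp_conj_def fold_gen_act_replicate_Gt simp del: fold_replicate)

lemma fold_gen_act_inv_lamp_conj:
  "fold gen_act (gword_inv (lamp_conj i)) s = fold gen_act (lamp_conj i) s"
proof -
  have "fold gen_act (lamp_conj i) (fold gen_act (lamp_conj i) s) = s"
    by (cases s) (simp add: fold_gen_act_lamp_conj)
  then show ?thesis
    using fold_gen_act_gword_inv[of "lamp_conj i" "fold gen_act (lamp_conj i) s"] by simp
qed

text \<open>A conjugate of \<open>a\<close> and its inverse act alike, so a commutator switches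
  lamps \<open>n + i\<close> and \<open>n + j\<close> twice each. Hence the action descends to the
  presented group.\<close>

lemma fold_gen_act_relator:
  assumes "r \<in> lamp_relators"
  shows "fold gen_act r s = s"
proof (cases s)
  case (Pair S n)
  have "fold gen_act (gword_comm (lamp_conj i) (lamp_conj j)) (S, n) = (S, n)" for i j
    by (simp add: gword_comm_def fold_gen_act_inv_lamp_conj fold_gen_act_lamp_conj
        toggle_commute[of "n + j"])
  then show ?thesis
    using assms Pair by (auto simp: lamp_relators_def)
qed

lemma fold_gen_act_cong:
  "pres_eq lamp_relators u v \<Longrightarrow> fold gen_act u s = fold gen_act v s"
  by (induction arbitrary: s rule: pres_eq.induct) (auto simp: fold_gen_act_relator)


section \<open>Products of commuting involutions\<close>

context group
begin

lemma word_value_closed [simp]: "set w \<subseteq> carrier G \<Longrightarrow> word_value G w \<in> carrier G"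
  by (induction w) (auto simp: word_value_def)

text \<open>The ambient group is not abelian, so the sorted list fixes an order of the factors. It
  becomes immaterial once the factors commute pairwise.\<close>

definition involution_prod :: "('i::linorder \<Rightarrow> 'a) \<Rightarrow> 'i set \<Rightarrow> 'a" where
  "involution_prod A S = word_value G (map A (sorted_list_of_set S))"

context
  fixes A :: "'i::linorder \<Rightarrow> 'a"
  assumes closed: "\<And>i. A i \<in> carrier G"
    and commute: "\<And>i j. A i \<otimes> A j = A j \<otimes> A i"
begin

lemma word_value_map_closed: "word_value G (map A xs) \<in> carrier G"
  by (rule word_value_closed) (use closed in auto)

lemma word_value_commute:
  "A x \<otimes> word_value G (map A xs) = word_value G (map A xs) \<otimes> A x"
proof (induction xs)
  case Nil
  show ?case using closed by (simp add: word_value_def)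
next
  case (Cons y xs)
  let ?P = "word_value G (map A xs)"
  have "A x \<otimes> (A y \<otimes> ?P) = A y \<otimes> (A x \<otimes> ?P)"
    using closed word_value_map_closed commute by (metis m_assoc)
  also have "\<dots> = A y \<otimes> ?P \<otimes> A x"
    using closed word_value_map_closed Cons by (metis m_assoc)
  finally show ?case by (simp add: word_value_def)
qed

lemma word_value_remove1:
  "x \<in> set xs \<Longrightarrow> word_value G (map A xs) = word_value G (map A (remove1 x xs)) \<otimes> A x"
proof (induction xs)
  case (Cons y xs)
  show ?case
  proof (cases "x = y")
    case True
    then show ?thesis using word_value_commute[of x xs] by (simp add: word_value_def)
  next
    case False
    then show ?thesis
      using Cons closed word_value_map_closed[of "remove1 x xs"]
      by (simp add: word_value_def m_assoc)
  qed
qed simp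

lemma involution_prod_closed: "involution_prod A S \<in> carrier G"
  by (simp add: involution_prod_def word_value_map_closed)

lemma involution_prod_remove:
  "finite S \<Longrightarrow> x \<in> S \<Longrightarrow> involution_prod A S = involution_prod A (S - {x}) \<otimes> A x"
  using word_value_remove1[of x "sorted_list_of_set S"]
  by (simp add: involution_prod_def sorted_list_of_set_remove)

text \<open>A factor already present can be moved to the end, where it meets its copy and squares to
  \<open>\<one>\<close>.\<close>

lemma involution_prod_toggle:
  assumes "finite S" "A x \<otimes> A x = \<one>"
  shows "involution_prod A (toggle x S) = involution_prod A S \<otimes> A x"
proof (cases "x \<in> S")
  case True
  have "involution_prod A S \<otimes> A x = involution_prod A (S - {x}) \<otimes> (A x \<otimes> A x)"
    using involution_prod_remove[OF assms(1) True] closed involution_prod_closed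
    by (simp add: m_assoc)
  then show ?thesis
    using True assms(2) involution_prod_closed by (simp add: toggle_def)
next
  case False
  then show ?thesis
    using involution_prod_remove[of "insert x S" x] assms(1) by (simp add: toggle_def)
qed

end

end


section \<open>Elements of the presented group are determined by their states\<close>

abbreviation lamp_class :: "lamp_gen gword \<Rightarrow> lamp_gen gword set" where
  "lamp_class \<equiv> pres_class lamp_relators"

interpretation L2: group L2
  by (rule group_L2)

lemma lamp_class_closed [simp]: "lamp_class u \<in> carrier L2"
  by (simp add: L2_def carrier_presented_group)

lemma lamp_class_mult: "lamp_class u \<otimes>\<^bsub>L2\<^esub> lamp_class v = lamp_class (u @ v)"
  by (simp add: L2_def presented_group_mult)

lemma lamp_class_Nil: "lamp_class [] = \<one>\<^bsub>L2\<^esub>"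
  by (simp add: L2_def one_presented_group)

lemma inv_lamp_class: "inv\<^bsub>L2\<^esub> (lamp_class u) = lamp_class (gword_inv u)"
proof (rule L2.inv_equality)
  show "lamp_class (gword_inv u) \<otimes>\<^bsub>L2\<^esub> lamp_class u = \<one>\<^bsub>L2\<^esub>"
    by (simp add: lamp_class_mult flip: lamp_class_Nil)
      (simp add: pres_class_eq_iff pres_eq_gword_inv)
qed auto

lemma lamp_class_cancel: "lamp_class (u @ [(x, b), (x, \<not> b)] @ v) = lamp_class (u @ v)"
  unfolding pres_class_eq_iff by (rule pres_eq.cancel)

lemma lamp_class_relator: "r \<in> lamp_relators \<Longrightarrow> lamp_class (u @ r @ v) = lamp_class (u @ v)"
  unfolding pres_class_eq_iff by (rule pres_eq.relator)

lemma lamp_class_Ga_Ga: "lamp_class (u @ [(Ga, True), (Ga, True)]) = lamp_class u"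
  using lamp_class_relator[of "[(Ga, True), (Ga, True)]" u "[]"] by (simp add: lamp_relators_def)

lemma lamp_class_Ga: "lamp_class [(Ga, b)] = lamp_class [(Ga, True)]"
proof (cases b)
  case False
  have "lamp_class [(Ga, False)] = lamp_class [(Ga, False), (Ga, True), (Ga, True)]"
    using lamp_class_Ga_Ga[of "[(Ga, False)]"] by simp
  also have "\<dots> = lamp_class [(Ga, True)]"
    using lamp_class_cancel[of "[]" Ga False "[(Ga, True)]"] by simp
  finally show ?thesis using False by simp
qed simp

section \<open>Powers of \<open>t\<close> and the conjugates of \<open>a\<close> by them\<close>

definition shift_word :: "int \<Rightarrow> lamp_gen gword" where
  "shift_word i = replicate (nat \<bar>i\<bar>) (Gt, 0 \<le> i)"

lemma lamp_conj_shift: "lamp_conj i = shift_word i @ [(Ga, True)] @ shift_word (- i)"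
  by (cases "i = 0") (auto simp: lamp_conj_def shift_word_def)

lemma shift_word_uminus: "shift_word (- i) = gword_inv (shift_word i)"
  by (cases "i = 0") (auto simp: shift_word_def gword_inv_def)

lemma lamp_class_shift_uminus:
  "lamp_class (shift_word (- i)) \<otimes>\<^bsub>L2\<^esub> lamp_class (shift_word i) = \<one>\<^bsub>L2\<^esub>"
  by (simp add: shift_word_uminus flip: inv_lamp_class)

lemma lamp_class_shift_succ:
  "lamp_class (shift_word i @ [(Gt, True)]) = lamp_class (shift_word (i + 1))"
proof (cases "0 \<le> i")
  case True
  then have "nat \<bar>i + 1\<bar> = Suc (nat \<bar>i\<bar>)" by simp
  then show ?thesis
    using True by (simp add: shift_word_def replicate_append_same)
next
  case False
  then have "nat \<bar>i\<bar> = Suc (nat \<bar>i + 1\<bar>)" by simp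
  then have "shift_word i = shift_word (i + 1) @ [(Gt, False)]"
    using False by (cases "i = -1") (simp_all add: shift_word_def replicate_append_same)
  then show ?thesis
    using lamp_class_cancel[of "shift_word (i + 1)" Gt False "[]"] by simp
qed

lemma lamp_class_shift_pred:
  "lamp_class (shift_word i @ [(Gt, False)]) = lamp_class (shift_word (i - 1))"
proof -
  have "lamp_class (shift_word i @ [(Gt, False)])
      = lamp_class (shift_word (i - 1) @ [(Gt, True)]) \<otimes>\<^bsub>L2\<^esub> lamp_class [(Gt, False)]"
    by (simp add: lamp_class_shift_succ lamp_class_mult)
  then show ?thesis
    using lamp_class_cancel[of "shift_word (i - 1)" Gt True "[]"] by (simp add: lamp_class_mult)
qed

definition lamp :: "int \<Rightarrow> lamp_gen gword set" where
  "lamp i = lamp_class (lamp_conj i)"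

lemma lamp_closed [simp]: "lamp i \<in> carrier L2"
  by (simp add: lamp_def)

text \<open>This is \<open>(t^i a t^-i) t^i = t^i a\<close>: a switch made at position
  \<open>i\<close> can be moved in front of the shift.\<close>

lemma lamp_shift:
  "lamp i \<otimes>\<^bsub>L2\<^esub> lamp_class (shift_word i) = lamp_class (shift_word i @ [(Ga, True)])"
proof -
  have "lamp i = lamp_class (shift_word i @ [(Ga, True)]) \<otimes>\<^bsub>L2\<^esub> lamp_class (shift_word (- i))"
    by (simp add: lamp_def lamp_conj_shift lamp_class_mult)
  then show ?thesis by (simp add: L2.m_assoc lamp_class_shift_uminus)
qed

lemma lamp_square: "lamp i \<otimes>\<^bsub>L2\<^esub> lamp i = \<one>\<^bsub>L2\<^esub>"
proof -
  let ?t = "lamp_class (shift_word i)" and ?a = "lamp_class [(Ga, True)]"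
  have t: "lamp i \<otimes>\<^bsub>L2\<^esub> ?t = ?t \<otimes>\<^bsub>L2\<^esub> ?a"
    by (simp add: lamp_shift lamp_class_mult)
  have "lamp i \<otimes>\<^bsub>L2\<^esub> lamp i \<otimes>\<^bsub>L2\<^esub> ?t = lamp i \<otimes>\<^bsub>L2\<^esub> (?t \<otimes>\<^bsub>L2\<^esub> ?a)"
    by (simp add: L2.m_assoc t)
  also have "\<dots> = ?t \<otimes>\<^bsub>L2\<^esub> ?a \<otimes>\<^bsub>L2\<^esub> ?a"
    by (simp flip: L2.m_assoc add: t)
  also have "\<dots> = ?t"
    using lamp_class_Ga_Ga[of "shift_word i"] by (simp add: lamp_class_mult)
  finally show ?thesis
    using L2.r_cancel_one[of "lamp_class (shift_word i)" "lamp i \<otimes>\<^bsub>L2\<^esub> lamp i"] by simp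
qed

lemma lamp_commute: "lamp i \<otimes>\<^bsub>L2\<^esub> lamp j = lamp j \<otimes>\<^bsub>L2\<^esub> lamp i"
proof -
  have "gword_comm (lamp_conj i) (lamp_conj j) \<in> lamp_relators"
    by (auto simp: lamp_relators_def)
  \<comment> \<open>The commutator is appended to \<open>lamp j\<close> times \<open>lamp i\<close>.
    It changes nothing as a relator, and free cancellation leaves \<open>lamp i\<close> times
    \<open>lamp j\<close>.\<close>
  from lamp_class_relator[OF this, of "lamp_conj j @ lamp_conj i" "[]"]
  have "lamp j \<otimes>\<^bsub>L2\<^esub> lamp i = lamp j \<otimes>\<^bsub>L2\<^esub> lamp i
      \<otimes>\<^bsub>L2\<^esub> (inv\<^bsub>L2\<^esub> lamp i \<otimes>\<^bsub>L2\<^esub> (inv\<^bsub>L2\<^esub> lamp j \<otimes>\<^bsub>L2\<^esub> (lamp i \<otimes>\<^bsub>L2\<^esub> lamp j)))"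
    by (simp add: gword_comm_def lamp_def lamp_class_mult inv_lamp_class)
  also have "\<dots> = lamp i \<otimes>\<^bsub>L2\<^esub> lamp j"
  proof -
    have "x \<otimes>\<^bsub>L2\<^esub> (inv\<^bsub>L2\<^esub> x \<otimes>\<^bsub>L2\<^esub> y) = y"
      if "x \<in> carrier L2" "y \<in> carrier L2" for x y
      using that by (simp flip: L2.m_assoc)
    then show ?thesis by (simp add: L2.m_assoc)
  qed
  finally show ?thesis by simp
qed

section \<open>Recovering a group element from its state\<close>

definition state_elt :: "lamp_state \<Rightarrow> lamp_gen gword set" where
  "state_elt s = L2.involution_prod lamp (fst s) \<otimes>\<^bsub>L2\<^esub> lamp_class (shift_word (snd s))"

definition gword_state :: "lamp_gen gword \<Rightarrow> lamp_state" where
  "gword_state u = fold gen_act u ({}, 0)"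

lemma finite_fold_gen_act: "finite (fst s) \<Longrightarrow> finite (fst (fold gen_act u s))"
proof (induction u arbitrary: s)
  case (Cons x u)
  have "finite (fst (gen_act x s))"
    using Cons.prems by (cases "(x, s)" rule: gen_act.cases) auto
  then show ?case using Cons.IH by simp
qed simp

lemma finite_gword_state: "finite (fst (gword_state u))"
  by (simp add: gword_state_def finite_fold_gen_act)

text \<open>For \<open>Ga\<close>, \<open>lamp_shift\<close> turns the trailing \<open>a\<close>
  into a factor \<open>lamp n\<close>, which \<open>involution_prod_toggle\<close> absorbs. For
  \<open>Gt\<close> only the power of \<open>t\<close> changes.\<close>

lemma state_elt_gen_act:
  assumes "finite (fst s)"
  shows "state_elt (gen_act x s) = state_elt s \<otimes>\<^bsub>L2\<^esub> lamp_class [x]"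
proof (cases "(x, s)" rule: gen_act.cases)
  case (1 b S n)
  let ?P = "L2.involution_prod lamp"
  have P: "?P U \<in> carrier L2" for U
    by (rule L2.involution_prod_closed) (auto simp: lamp_commute)
  have "state_elt s \<otimes>\<^bsub>L2\<^esub> lamp_class [x]
      = ?P S \<otimes>\<^bsub>L2\<^esub> lamp_class (shift_word n @ [(Ga, True)])"
    using 1 P by (simp add: state_elt_def L2.m_assoc lamp_class_Ga[of b] lamp_class_mult[symmetric])
  also have "\<dots> = ?P S \<otimes>\<^bsub>L2\<^esub> lamp n \<otimes>\<^bsub>L2\<^esub> lamp_class (shift_word n)"
    using P by (simp add: L2.m_assoc lamp_shift)
  also have "?P S \<otimes>\<^bsub>L2\<^esub> lamp n = ?P (toggle n S)"
    using assms 1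
    by (intro L2.involution_prod_toggle[symmetric]) (auto simp: lamp_commute lamp_square)
  finally show ?thesis using 1 by (simp add: state_elt_def)
next
  case (2 b S n)
  have P: "L2.involution_prod lamp S \<in> carrier L2"
    by (rule L2.involution_prod_closed) (auto simp: lamp_commute)
  then show ?thesis
    using 2 by (cases b) (simp_all add: state_elt_def L2.m_assoc lamp_class_mult
        lamp_class_shift_succ lamp_class_shift_pred)
qed

lemma lamp_class_eq_state_elt: "lamp_class u = state_elt (gword_state u)"
proof (induction u rule: rev_induct)
  case Nil
  show ?case
    by (simp add: gword_state_def state_elt_def L2.involution_prod_def word_value_def
        shift_word_def lamp_class_Nil)
next
  case (snoc x u)
  have "state_elt (gword_state (u @ [x])) = state_elt (gen_act x (gword_state u))"
    by (simp add: gword_state_def)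
  then show ?case
    using snoc by (simp add: state_elt_gen_act finite_gword_state lamp_class_mult[symmetric])
qed

text \<open>Equal classes give equal states because relators act trivially. Conversely,
  \<open>state_elt\<close> rebuilds the class from the state.\<close>

lemma lamp_class_eq_iff: "lamp_class u = lamp_class v \<longleftrightarrow> gword_state u = gword_state v"
  using lamp_class_eq_state_elt fold_gen_act_cong
  by (metis gword_state_def pres_class_eq_iff)


section \<open>The generating set of the theorem\<close>

text \<open>The element represented by \<open>(S, n)\<close> is reached by a path from \<open>0\<close> to \<open>n\<close> in \<open>\<int>\<close>: the
  letters \<open>t\<close> and \<open>ta\<close> step to the right, their inverses to the left, and \<open>ta\<close> and its inverse also
  switch the lamp that sits on the edge being crossed, lamp \<open>i\<close> sitting between \<open>i - 1\<close> and \<open>i\<close>.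
  A letter is a pair (step to the right, switch the lamp).\<close>

fun step_word :: "bool \<times> bool \<Rightarrow> lamp_gen gword" where
  "step_word (True, b) = (Gt, True) # (if b then [(Ga, True)] else [])"
| "step_word (False, b) = (if b then [(Ga, False)] else []) @ [(Gt, False)]"

definition step_letter :: "bool \<times> bool \<Rightarrow> lamp_gen gword set" where
  "step_letter x = lamp_class (step_word x)"

fun step :: "bool \<times> bool \<Rightarrow> lamp_state \<Rightarrow> lamp_state" where
  "step (True, b) (S, n) = (if b then toggle (n + 1) S else S, n + 1)"
| "step (False, b) (S, n) = (if b then toggle n S else S, n - 1)"

definition steps_state :: "(bool \<times> bool) list \<Rightarrow> lamp_state" where
  "steps_state w = fold step w ({}, 0)"

lemma range_step_letter: "range step_letter = sym_alphabet L2 L2_gens"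
proof -
  have "L2_t = step_letter (True, False)"
    "L2_t \<otimes>\<^bsub>L2\<^esub> L2_a = step_letter (True, True)"
    "inv\<^bsub>L2\<^esub> L2_t = step_letter (False, False)"
    "inv\<^bsub>L2\<^esub> (L2_t \<otimes>\<^bsub>L2\<^esub> L2_a) = step_letter (False, True)"
    by (simp_all add: L2_t_def L2_a_def step_letter_def lamp_class_mult inv_lamp_class
        gword_inv_def)
  then have "sym_alphabet L2 L2_gens
      = step_letter ` {(True, False), (True, True), (False, False), (False, True)}"
    unfolding sym_alphabet_def L2_gens_def by auto
  also have "{(True, False), (True, True), (False, False), (False, True)} = UNIV"
    by auto
  finally show ?thesis ..
qed

lemma word_value_step_letter:
  "word_value L2 (map step_letter w) = lamp_class (concat (map step_word w))"
  by (induction w) (auto simp: word_value_def lamp_class_Nil step_letter_def lamp_class_mult)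

lemma fold_gen_act_step_word: "fold gen_act (step_word x) s = step x s"
  by (cases "(x, s)" rule: step.cases) auto

lemma gword_state_step_words: "gword_state (concat (map step_word w)) = steps_state w"
proof -
  have "fold gen_act (concat (map step_word w)) s = fold step w s" for s
    by (induction w arbitrary: s) (auto simp: fold_gen_act_step_word)
  then show ?thesis by (simp add: gword_state_def steps_state_def)
qed

lemma word_value_eq_lamp_class_iff:
  "word_value L2 (map step_letter w) = lamp_class u \<longleftrightarrow> steps_state w = gword_state u"
  by (simp add: word_value_step_letter lamp_class_eq_iff gword_state_step_words)

lemma word_value_eq_iff:
  "word_value L2 (map step_letter v) = word_value L2 (map step_letter w)
    \<longleftrightarrow> steps_state v = steps_state w"
  by (simp add: word_value_step_letter lamp_class_eq_iff gword_state_step_words)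

text \<open>Reflecting positions by \<open>n \<mapsto> - n\<close> sends the edge from
  \<open>i - 1\<close> to \<open>i\<close> to the edge from \<open>- i\<close> to
  \<open>1 - i\<close>, which carries lamp \<open>1 - i\<close>.\<close>

definition mirror :: "lamp_state \<Rightarrow> lamp_state" where
  "mirror s = ((\<lambda>i. 1 - i) ` fst s, - snd s)"

lemma mirror_mirror [simp]: "mirror (mirror s) = s"
  by (simp add: mirror_def image_image)

lemma image_toggle: "inj f \<Longrightarrow> f ` toggle x S = toggle (f x) (f ` S)"
  by (auto simp: toggle_def inj_eq)

lemma step_mirror: "step (apfst Not x) (mirror s) = mirror (step x s)"
  by (cases "(x, s)" rule: step.cases) (auto simp: mirror_def image_toggle inj_def)

lemma steps_state_mirror: "steps_state (map (apfst Not) w) = mirror (steps_state w)"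
proof -
  have "fold step (map (apfst Not) w) (mirror s) = mirror (fold step w s)" for s
    by (induction w arbitrary: s) (auto simp: step_mirror)
  from this[of "({}, 0)"] show ?thesis
    by (simp add: steps_state_def mirror_def)
qed

text \<open>The interval \<open>[m, M]\<close> swept by the path has to be crossed twice, up to the part between
  \<open>0\<close> and the endpoint.\<close>

lemma steps_state_bounds:
  "steps_state w = (S, n) \<Longrightarrow>
    \<exists>m M. m \<le> 0 \<and> 0 \<le> M \<and> m \<le> n \<and> n \<le> M \<and> S \<subseteq> {m<..M} \<and> 2 * (M - m) - \<bar>n\<bar> \<le> int (length w)"
proof (induction w arbitrary: S n rule: rev_induct)
  case Nil
  then show ?case by (intro exI[of _ 0]) (simp add: steps_state_def)
next
  case (snoc x w)
  obtain S' n' where s: "steps_state w = (S', n')" by (cases "steps_state w")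
  from snoc.IH[OF this] obtain m M where
    b: "m \<le> 0" "0 \<le> M" "m \<le> n'" "n' \<le> M" "S' \<subseteq> {m<..M}" "2 * (M - m) - \<bar>n'\<bar> \<le> int (length w)"
    by blast
  have "step x (S', n') = (S, n)"
    using snoc.prems s by (simp add: steps_state_def)
  then have x: "n = n' + 1 \<and> S \<subseteq> insert (n' + 1) S' \<or> n = n' - 1 \<and> S \<subseteq> insert n' S'"
    by (cases "(x, (S', n'))" rule: step.cases) (auto simp: toggle_def split: if_splits)
  then consider (right) "n = n' + 1" "S \<subseteq> insert n S'" | (left) "n = n' - 1" "S \<subseteq> insert n' S'"
    by auto
  then show ?case
  proof cases
    case right
    have "S \<subseteq> {m<..max M n}" using right b(3,5) by fastforce
    \<comment> \<open>If the interval grows, then \<open>n' = M\<close> is nonnegative, so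
      \<open>\<bar>n\<bar>\<close> grows as well and the left side rises by
      \<open>2 - 1 = 1\<close>. Otherwise only \<open>\<bar>n\<bar>\<close> changes, by 1.\<close>
    moreover have "2 * (max M n - m) - \<bar>n\<bar> \<le> int (length (w @ [x]))"
      using right b(1-4,6) by (simp add: max_def abs_if split: if_splits)
    ultimately show ?thesis
      using right b(1-3) by (intro exI[of _ m] exI[of _ "max M n"]) auto
  next
    case left
    have "S \<subseteq> {min m n<..M}" using left b(3-5) by fastforce
    moreover have "2 * (M - min m n) - \<bar>n\<bar> \<le> int (length (w @ [x]))"
      using left b(1-4,6) by (simp add: min_def abs_if split: if_splits)
    ultimately show ?thesis
      using left b(1,2,4) by (intro exI[of _ "min m n"] exI[of _ M]) auto
  qed
qed


section \<open>The normal forms\<close>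

text \<open>With \<open>d = True\<close> this is the word \<open>t^-k v t^-j\<close>, where
  \<open>bs\<close> tells which letters of \<open>v\<close> are \<open>ta\<close>.
  \<open>d = False\<close> gives its mirror image.\<close>

definition zigzag :: "bool \<Rightarrow> nat \<Rightarrow> bool list \<Rightarrow> nat \<Rightarrow> (bool \<times> bool) list" where
  "zigzag d k bs j = replicate k (\<not> d, False) @ map (Pair d) bs @ replicate j (\<not> d, False)"

text \<open>The strict inequality for \<open>d = False\<close> makes the two directions disjoint: \<open>d\<close> tells whether
  the endpoint is nonnegative.\<close>

definition admissible :: "bool \<Rightarrow> nat \<Rightarrow> bool list \<Rightarrow> nat \<Rightarrow> bool" where
  "admissible d k bs j \<longleftrightarrow> (0 < k \<longrightarrow> hd bs) \<and> (0 < j \<longrightarrow> last bs) \<and>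
     k + j + (if d then 0 else 1) \<le> length bs"

definition normal_words :: "(bool \<times> bool) list set" where
  "normal_words = {zigzag d k bs j | d k bs j. admissible d k bs j}"

lemma normal_wordsI: "admissible d k bs j \<Longrightarrow> zigzag d k bs j \<in> normal_words"
  unfolding normal_words_def by blast

lemma length_zigzag [simp]: "length (zigzag d k bs j) = k + length bs + j"
  by (simp add: zigzag_def)

lemma zigzag_mirror: "zigzag (\<not> d) k bs j = map (apfst Not) (zigzag d k bs j)"
  by (simp add: zigzag_def)

section \<open>Lamps and endpoint of a normal form\<close>

lemma fold_step_replicate_left:
  "fold step (replicate k (False, False)) (S, n) = (S, n - int k)"
  by (induction k arbitrary: n) auto

definition lit :: "bool list \<Rightarrow> nat set" where
  "lit bs = {i. i < length bs \<and> bs ! i}"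

lemma lit_snoc: "lit (bs @ [b]) = (if b then insert (length bs) (lit bs) else lit bs)"
  by (auto simp: lit_def nth_append less_Suc_eq)

lemma fold_step_right:
  "fold step (map (Pair True) bs) ({}, n)
    = ((\<lambda>i. n + 1 + int i) ` lit bs, n + int (length bs))"
proof (induction bs rule: rev_induct)
  case Nil
  show ?case by (simp add: lit_def)
next
  case (snoc b bs)
  \<comment> \<open>The next edge has not been crossed yet, so toggling its lamp can only light
    it.\<close>
  have "n + int (length bs) + 1 \<notin> (\<lambda>i. n + 1 + int i) ` lit bs"
    by (auto simp: lit_def)
  then show ?case
    using snoc by (simp add: toggle_def lit_snoc add.commute add.left_commute)
qed

lemma steps_state_zigzag:
  "steps_state (zigzag True k bs j)
    = ((\<lambda>i. 1 - int k + int i) ` lit bs, int (length bs) - int k - int j)"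
  by (simp add: steps_state_def zigzag_def fold_step_replicate_left fold_step_right
      del: fold_replicate)

text \<open>If \<open>k > 0\<close>, the first middle step lights lamp \<open>1 - k\<close>; if
  \<open>j > 0\<close>, the last one lights lamp \<open>n + j\<close>. An interval containing
  \<open>S\<close> must reach both. This yields minimal length as well as uniqueness.\<close>

lemma zigzag_extremal:
  assumes "admissible True k bs j" "steps_state (zigzag True k bs j) = (S, n)"
    and "S \<subseteq> {m<..M}" "m \<le> 0" "n \<le> M"
  shows "int k \<le> - m" "n + int j \<le> M"
proof -
  have S: "S = (\<lambda>i. 1 - int k + int i) ` lit bs"
    and n: "n = int (length bs) - int k - int j"
    using assms(2) by (auto simp: steps_state_zigzag)
  show "int k \<le> - m"
  proof (cases "k = 0")
    case False
    \<comment> \<open>The length condition gives \<open>k \<le> length bs\<close>, so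
      \<open>hd bs\<close> is a genuine first entry.\<close>
    then have "0 < length bs" "hd bs"
      using assms(1) by (auto simp: admissible_def)
    then have "0 \<in> lit bs" by (simp add: lit_def hd_conv_nth)
    then have "1 - int k + int 0 \<in> S" unfolding S by (rule imageI)
    then show ?thesis using assms(3) by auto
  qed (use assms in auto)
  show "n + int j \<le> M"
  proof (cases "j = 0")
    case False
    then have "length bs - 1 < length bs" "last bs"
      using assms(1) by (auto simp: admissible_def)
    then have "length bs - 1 \<in> lit bs"
      by (cases "bs = []") (simp_all add: lit_def last_conv_nth)
    then have "1 - int k + int (length bs - 1) \<in> S" unfolding S by (rule imageI)
    then show ?thesis using assms(3) \<open>length bs - 1 < length bs\<close> n by auto
  qed (use assms in auto)
qed

text \<open>Since \<open>length bs = n + k + j\<close>, the length of the zigzag is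
  \<open>2 * (n + j + k) - n\<close>, at most the lower bound
  \<open>2 * (M - m) - \<bar>n\<bar>\<close> for \<open>w\<close>.\<close>

lemma zigzag_shortest_right:
  assumes "admissible True k bs j" "steps_state w = steps_state (zigzag True k bs j)"
  shows "k + length bs + j \<le> length w"
proof -
  obtain S n where s: "steps_state (zigzag True k bs j) = (S, n)"
    by (cases "steps_state (zigzag True k bs j)")
  obtain m M where "m \<le> 0" "n \<le> M" "S \<subseteq> {m<..M}" "2 * (M - m) - \<bar>n\<bar> \<le> int (length w)"
    using steps_state_bounds[of w S n] assms(2) s by auto
  moreover from zigzag_extremal[OF assms(1) s this(3,1,2)]
  have "int k \<le> - m" "n + int j \<le> M" .
  moreover have "n = int (length bs) - int k - int j" "0 \<le> n"
    using s assms(1) by (auto simp: steps_state_zigzag admissible_def)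
  ultimately show ?thesis by simp
qed

lemma admissible_True: "admissible d k bs j \<Longrightarrow> admissible True k bs j"
  by (auto simp: admissible_def split: if_splits)

lemma zigzag_shortest:
  assumes "admissible d k bs j" "steps_state w = steps_state (zigzag d k bs j)"
  shows "k + length bs + j \<le> length w"
proof (cases d)
  case True
  then show ?thesis using zigzag_shortest_right[of k bs j w] assms by simp
next
  case False
  then have "steps_state (map (apfst Not) w) = steps_state (zigzag True k bs j)"
    using assms(2) zigzag_mirror[of True k bs j] by (simp add: steps_state_mirror)
  from zigzag_shortest_right[OF admissible_True[OF assms(1)] this] show ?thesis by simp
qed

text \<open>Each word is extremal for the interval swept by the other, which forces
  \<open>k = k'\<close> and \<open>j = j'\<close>. The bits are then read off the lit lamps.\<close>

lemma zigzag_unique_right: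
  assumes "admissible True k bs j" "admissible True k' bs' j'"
    and eq: "steps_state (zigzag True k bs j) = steps_state (zigzag True k' bs' j')"
  shows "k = k' \<and> bs = bs' \<and> j = j'"
proof -
  have le: "k \<le> k'" "j \<le> j'"
    if "admissible True k bs j" "admissible True k' bs' j'"
      "steps_state (zigzag True k bs j) = steps_state (zigzag True k' bs' j')"
    for k bs j k' bs' j'
  proof -
    obtain S n where s: "steps_state (zigzag True k bs j) = (S, n)"
      by (cases "steps_state (zigzag True k bs j)")
    have s': "S = (\<lambda>i. 1 - int k' + int i) ` lit bs'"
      "n = int (length bs') - int k' - int j'"
      using s that(3) by (simp_all add: steps_state_zigzag)
    have "S \<subseteq> {- int k'<..n + int j'}" unfolding s' by (auto simp: lit_def)
    from zigzag_extremal[OF that(1) s this] show "k \<le> k'" "j \<le> j'" by auto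
  qed
  have kj: "k = k'" "j = j'"
    using le[OF assms] le[OF assms(2,1) eq[symmetric]] by auto
  have len: "length bs = length bs'"
    using eq kj by (simp add: steps_state_zigzag)
  have "bs ! i = bs' ! i" if "i < length bs" for i
  proof -
    have "bs ! i \<longleftrightarrow> 1 - int k + int i \<in> fst (steps_state (zigzag True k bs j))"
      using that by (auto simp: steps_state_zigzag lit_def)
    also have "\<dots> \<longleftrightarrow> bs' ! i"
      unfolding eq using that kj len by (auto simp: steps_state_zigzag lit_def)
    finally show ?thesis .
  qed
  then show ?thesis using kj len by (auto intro: nth_equalityI)
qed

text \<open>The endpoint is \<open>length bs - k - j\<close>, negated if \<open>d\<close> is false,
  in which case the extra 1 in \<open>admissible\<close> keeps it away from
  \<open>0\<close>.\<close>

lemma zigzag_endpoint: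
  assumes "admissible d k bs j"
  shows "0 \<le> snd (steps_state (zigzag d k bs j)) \<longleftrightarrow> d"
proof (cases d)
  case True
  then show ?thesis using assms by (auto simp: steps_state_zigzag admissible_def)
next
  case False
  then show ?thesis
    using assms zigzag_mirror[of True k bs j]
    by (auto simp: steps_state_mirror mirror_def steps_state_zigzag admissible_def)
qed

lemma inj_on_steps_state: "inj_on steps_state normal_words"
proof (rule inj_onI)
  fix v w assume "v \<in> normal_words" "w \<in> normal_words" and eq: "steps_state v = steps_state w"
  then obtain d k bs j d' k' bs' j' where
    v: "v = zigzag d k bs j" "admissible d k bs j" and
    w: "w = zigzag d' k' bs' j'" "admissible d' k' bs' j'"
    by (auto simp: normal_words_def)
  have d: "d = d'"
    using zigzag_endpoint[OF v(2)] zigzag_endpoint[OF w(2)] eq v(1) w(1) by simp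
  have "steps_state (zigzag True k bs j) = steps_state (zigzag True k' bs' j')"
  proof (cases d)
    case False
    then show ?thesis
      using eq v(1) w(1) d zigzag_mirror[of False k bs j] zigzag_mirror[of False k' bs' j']
      by (simp add: steps_state_mirror)
  qed (use eq v(1) w(1) d in simp)
  from zigzag_unique_right[OF admissible_True[OF v(2)] admissible_True[OF w(2)] this]
  show "v = w" using v(1) w(1) d by simp
qed

section \<open>Existence of normal forms\<close>

lemma zigzag_exists_right:
  assumes "finite S" "0 \<le> n"
  shows "\<exists>k bs j. admissible True k bs j \<and> steps_state (zigzag True k bs j) = (S, n)"
proof -
  \<comment> \<open>For empty \<open>S\<close> the value of \<open>Max\<close> is unspecified, but
    the bound is then vacuous.\<close>
  obtain B where B: "\<And>i. i \<in> S \<Longrightarrow> \<bar>i\<bar> \<le> B"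
    by (rule that[of "Max (abs ` S)"]) (use assms(1) in auto)
  have "- int (nat (B + 1)) < i" if "i \<in> S" for i
    using B[OF that] by linarith
  then have "\<exists>k. \<forall>i\<in>S. - int k < i" by blast
  \<comment> \<open>\<open>k\<close> is taken least, and so is \<open>j\<close> below. Minimality
    makes the outermost edge lit on each side that is extended, as \<open>admissible\<close>
    demands.\<close>
  then obtain k where k: "\<forall>i\<in>S. - int k < i" and k_least: "\<And>k'. k' < k \<Longrightarrow> \<exists>i\<in>S. i \<le> - int k'"
    unfolding exists_least_iff[of "\<lambda>k. \<forall>i\<in>S. - int k < i"] by (auto simp: not_less)
  have "i \<le> n + int (nat B)" if "i \<in> S" for i
    using B[OF that] assms(2) by linarith
  then have "\<exists>j. \<forall>i\<in>S. i \<le> n + int j" by blast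
  then obtain j where j: "\<forall>i\<in>S. i \<le> n + int j" and j_least: "\<And>j'. j' < j \<Longrightarrow> \<exists>i\<in>S. n + int j' < i"
    unfolding exists_least_iff[of "\<lambda>j. \<forall>i\<in>S. i \<le> n + int j"] by (auto simp: not_le)
  have k_min: "1 - int k \<in> S" if k0: "0 < k"
  proof -
    obtain i where i: "i \<in> S" "i \<le> - int (k - 1)" using k_least[of "k - 1"] k0 by auto
    moreover have "- int k < i" using k i(1) by blast
    ultimately have "i = 1 - int k" using k0 by linarith
    then show ?thesis using i(1) by simp
  qed
  have j_min: "n + int j \<in> S" if j0: "0 < j"
  proof -
    obtain i where i: "i \<in> S" "n + int (j - 1) < i" using j_least[of "j - 1"] j0 by auto
    moreover have "i \<le> n + int j" using j i(1) by blast
    ultimately have "i = n + int j" using j0 by linarith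
    then show ?thesis using i(1) by simp
  qed
  \<comment> \<open>The middle run crosses every edge from \<open>- k\<close> to
    \<open>n + j\<close> once; entry \<open>i\<close> of \<open>bs\<close> belongs to lamp
    \<open>1 - k + i\<close>.\<close>
  define l where "l = nat n + k + j"
  define bs where "bs = map (\<lambda>i. 1 - int k + int i \<in> S) [0..<l]"
  have len: "length bs = l" by (simp add: bs_def)
  have "hd bs" if "0 < k"
    using k_min[OF that] that by (simp add: bs_def l_def hd_map)
  moreover have "last bs" if "0 < j"
  proof -
    have "1 - int k + int (l - 1) = n + int j"
      using that assms(2) by (simp add: l_def of_nat_diff)
    then show ?thesis
      using j_min[OF that] that by (simp add: bs_def l_def last_map)
  qed
  ultimately have "admissible True k bs j"
    by (simp add: admissible_def len l_def)
  moreover have "(\<lambda>i. 1 - int k + int i) ` lit bs = S"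
  proof (intro equalityI subsetI)
    fix i assume "i \<in> S"
    then have "- int k < i" "i \<le> n + int j" using k j by auto
    then have "i = 1 - int k + int (nat (i - 1 + int k))" "nat (i - 1 + int k) < l"
      using assms(2) by (auto simp: l_def)
    moreover from this have "nat (i - 1 + int k) \<in> lit bs"
      using \<open>i \<in> S\<close> by (simp add: lit_def bs_def)
    ultimately show "i \<in> (\<lambda>i. 1 - int k + int i) ` lit bs" by (intro image_eqI)
  qed (auto simp: lit_def bs_def)
  ultimately have "admissible True k bs j \<and> steps_state (zigzag True k bs j) = (S, n)"
    using assms(2) len by (simp add: steps_state_zigzag l_def)
  then show ?thesis by blast
qed

lemma normal_words_exists:
  assumes "finite S"
  shows "\<exists>w\<in>normal_words. steps_state w = (S, n)"
proof (cases "0 \<le> n")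
  case True
  then show ?thesis
    using zigzag_exists_right[OF assms True] normal_wordsI by metis
next
  case False
  define S' where "S' = fst (mirror (S, n))"
  have S': "mirror (S, n) = (S', - n)" "finite S'"
    using assms by (simp_all add: S'_def mirror_def)
  have "0 \<le> - n" using False by simp
  from zigzag_exists_right[OF S'(2) this] obtain k bs j where
    w: "admissible True k bs j" "steps_state (zigzag True k bs j) = (S', - n)" by blast
  \<comment> \<open>As \<open>n < 0\<close>, this yields the strict length inequality required for
    \<open>d = False\<close>.\<close>
  have "n = int k + int j - int (length bs)"
    using w(2) by (simp add: steps_state_zigzag)
  then have "admissible False k bs j"
    using w(1) False by (simp add: admissible_def)
  then have "zigzag False k bs j \<in> normal_words" by (rule normal_wordsI)
  moreover have "steps_state (zigzag False k bs j) = mirror (steps_state (zigzag True k bs j))"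
    using zigzag_mirror[of True k bs j] by (simp add: steps_state_mirror)
  then have "steps_state (zigzag False k bs j) = (S, n)"
    unfolding w(2) S'(1)[symmetric] by simp
  ultimately show ?thesis by (rule bexI[rotated])
qed


section \<open>The automaton\<close>

text \<open>Runs grow at their end, so an invariant can relate the prefix read so far to the
  counter. Every edge reads a letter.\<close>

inductive run :: "('q \<times> 'l \<times> int \<times> 'q) set \<Rightarrow> 'q \<Rightarrow> 'l list \<Rightarrow> int \<Rightarrow> 'q \<Rightarrow> bool" for E s where
  Nil: "run E s [] 0 s"
| snoc: "run E s w c p \<Longrightarrow> (p, x, h, q) \<in> E \<Longrightarrow> run E s (w @ [x]) (c + h) q"

lemma is_path_append:
  "is_path M p (es @ fs) q \<longleftrightarrow> (\<exists>r. is_path M p es r \<and> is_path M r fs q)"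
  by (induction es arbitrary: p) auto

lemma path_word_snoc: "path_word (es @ [(p, Some x, h, q)]) = path_word es @ [x]"
  by (simp add: path_word_def)

lemma path_value_integer_group_snoc:
  "path_value integer_group (es @ [(p, l, h, q)]) = path_value integer_group es + h"
proof -
  have "word_value integer_group (w @ [h]) = word_value integer_group w + h" for w
    by (induction w) (auto simp: word_value_def)
  then show ?thesis by (simp add: path_value_def)
qed

text \<open>Vertices are numbered injectively by \<open>v\<close> and letters are renamed by
  \<open>f\<close>, which turns runs into paths and back.\<close>

lemma accepted_by_one_counter_run:
  fixes E :: "('q::finite \<times> 'l \<times> int \<times> 'q) set" and f :: "'l \<Rightarrow> 'a"
  assumes "finite E"
  shows "accepted_by_one_counter (range f) (map f ` {w. \<exists>q\<in>F. run E s w 0 q})"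
proof -
  obtain v :: "'q \<Rightarrow> nat" where v: "inj v"
    using finite_imp_inj_to_nat_seg[OF finite_UNIV] by blast
  define M :: "(nat, 'a, int) group_automaton" where
    "M = \<lparr>vertices = range v, start_vertex = v s, accept_vertices = v ` F,
      edges = (\<lambda>(p, x, h, q). (v p, Some (f x), h, v q)) ` E\<rparr>"
  have "is_group_automaton integer_group (range f) M"
    using assms by (auto simp: is_group_automaton_def M_def)
  moreover have fwd: "\<exists>es. is_path M (v s) es (v q) \<and> path_word es = map f w
      \<and> path_value integer_group es = c" if "run E s w c q" for w c q
    using that
  proof induction
    case Nil
    show ?case by (rule exI[of _ "[]"]) (simp add: path_word_def path_value_def word_value_def)
  next
    case (snoc w c p x h q)
    then obtain es where "is_path M (v s) es (v p)" "path_word es = map f w"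
      "path_value integer_group es = c" by blast
    moreover have "(v p, Some (f x), h, v q) \<in> edges M"
      using snoc.hyps by (force simp: M_def)
    ultimately show ?case
      by (intro exI[of _ "es @ [(v p, Some (f x), h, v q)]"])
        (auto simp: is_path_append path_word_snoc path_value_integer_group_snoc)
  qed
  moreover have bwd: "\<exists>w q. r = v q \<and> path_word es = map f w
      \<and> run E s w (path_value integer_group es) q" if "is_path M (v s) es r" for es r
    using that
  proof (induction es arbitrary: r rule: rev_induct)
    case Nil
    then show ?case
      by (auto simp: path_word_def path_value_def word_value_def intro: run.Nil)
  next
    case (snoc e es)
    then obtain p' where p': "is_path M (v s) es p'" "e \<in> edges M" "fst e = p'"
      "snd (snd (snd e)) = r" by (auto simp: is_path_append)
    from snoc.IH[OF p'(1)] obtain w p where w: "p' = v p" "path_word es = map f w"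
      "run E s w (path_value integer_group es) p" by blast
    \<comment> \<open>Injectivity of \<open>v\<close> ensures that the preimage of the last edge
      starts at the vertex \<open>p\<close> where the run ended.\<close>
    obtain x h q where e: "e = (v p, Some (f x), h, v q)" "(p, x, h, q) \<in> E"
      using p'(2,3) w(1) v by (auto simp: M_def inj_eq)
    have "run E s (w @ [x]) (path_value integer_group (es @ [e])) q"
      using run.snoc[OF w(3) e(2)] e(1) by (simp add: path_value_integer_group_snoc)
    moreover have "path_word (es @ [e]) = map f (w @ [x])"
      using w(2) e(1) by (simp add: path_word_snoc)
    ultimately show ?case
      using e(1) p'(4) by (intro exI[of _ "w @ [x]"] exI[of _ q]) simp
  qed
  have "accepted_language integer_group M = map f ` {w. \<exists>q\<in>F. run E s w 0 q}"
  proof (intro equalityI subsetI)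
    fix u assume "u \<in> accepted_language integer_group M"
    then obtain q es where q: "q \<in> F" and es: "is_path M (v s) es (v q)" "path_word es = u"
      "path_value integer_group es = 0"
      by (auto simp: accepted_language_def M_def)
    from bwd[OF es(1)] obtain w q' where "v q = v q'" "u = map f w" "run E s w 0 q'"
      using es by auto
    then show "u \<in> map f ` {w. \<exists>q\<in>F. run E s w 0 q}"
      using q v by (auto simp: inj_eq)
  next
    fix u assume "u \<in> map f ` {w. \<exists>q\<in>F. run E s w 0 q}"
    then obtain w q where "q \<in> F" "run E s w 0 q" "u = map f w" by auto
    with fwd[of w 0 q] show "u \<in> accepted_language integer_group M"
      by (auto simp: accepted_language_def M_def)
  qed
  ultimately show ?thesis unfolding accepted_by_one_counter_def by blast
qed

text \<open>The first parameter is the direction \<open>d\<close>. \<open>Mid\<close> also remembers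
  the last bit, because the closing run may begin only after a \<open>True\<close>.\<close>

datatype vertex = Start | Pre bool | Mid bool bool | Post bool

instance vertex :: finite
proof
  have "(UNIV :: vertex set) = insert Start (range Pre \<union> range (case_prod Mid) \<union> range Post)"
    by (auto simp: image_iff) (metis vertex.exhaust)
  then show "finite (UNIV :: vertex set)" by (metis finite finite_UnI finite_imageI finite_insert)
qed

text \<open>The counter goes down on the outer steps of a normal form and may go up on each of its middle
  steps, so that it can end at \<open>0\<close> iff there are at least as many middle steps as outer ones. For
  \<open>d = False\<close> the first middle step may not go up, which makes the inequality strict.\<close>

inductive_set zigzag_edges :: "(vertex \<times> (bool \<times> bool) \<times> int \<times> vertex) set" where
  start_pre: "(Start, (\<not> d, False), - 1, Pre d) \<in> zigzag_edges"
| pre_pre: "(Pre d, (\<not> d, False), - 1, Pre d) \<in> zigzag_edges"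
| start_mid: "c = 0 \<or> c = 1 \<and> d \<Longrightarrow> (Start, (d, b), c, Mid d b) \<in> zigzag_edges"
| pre_mid: "c = 0 \<or> c = 1 \<and> d \<Longrightarrow> (Pre d, (d, True), c, Mid d True) \<in> zigzag_edges"
| mid_mid: "c = 0 \<or> c = 1 \<Longrightarrow> (Mid d b, (d, b'), c, Mid d b') \<in> zigzag_edges"
| mid_post: "(Mid d True, (\<not> d, False), - 1, Post d) \<in> zigzag_edges"
| post_post: "(Post d, (\<not> d, False), - 1, Post d) \<in> zigzag_edges"

definition zigzag_accept :: "vertex set" where
  "zigzag_accept = insert Start (range (case_prod Mid) \<union> range Post)"

lemma finite_zigzag_edges: "finite zigzag_edges"
proof (rule finite_subset)
  show "zigzag_edges \<subseteq> UNIV \<times> UNIV \<times> {- 1, 0, 1} \<times> UNIV"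
    by (auto elim: zigzag_edges.cases)
qed simp

text \<open>Middle steps choose their increments freely, so the counter is known only up to an
  interval: its lower end adds nothing, its upper end adds 1 wherever that is allowed.\<close>

fun run_spec :: "(bool \<times> bool) list \<Rightarrow> int \<Rightarrow> vertex \<Rightarrow> bool" where
  "run_spec w c Start \<longleftrightarrow> w = [] \<and> c = 0"
| "run_spec w c (Pre d) \<longleftrightarrow> (\<exists>k>0. w = zigzag d k [] 0 \<and> c = - int k)"
| "run_spec w c (Mid d b) \<longleftrightarrow> (\<exists>k bs. w = zigzag d k bs 0 \<and> bs \<noteq> [] \<and> (0 < k \<longrightarrow> hd bs) \<and>
     last bs = b \<and> - int k \<le> c \<and> c \<le> int (length bs) - int k - (if d then 0 else 1))"
| "run_spec w c (Post d) \<longleftrightarrow> (\<exists>k bs j. w = zigzag d k bs j \<and> bs \<noteq> [] \<and> (0 < k \<longrightarrow> hd bs) \<and>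
     last bs \<and> 0 < j \<and> - int k - int j \<le> c \<and>
     c \<le> int (length bs) - int k - int j - (if d then 0 else 1))"

section \<open>Soundness of the counter invariant\<close>

lemma run_spec_PostI:
  assumes "w = zigzag d k bs j" "bs \<noteq> []" "0 < k \<longrightarrow> hd bs" "last bs" "0 < j"
    "- int k - int j \<le> c" "c \<le> int (length bs) - int k - int j - (if d then 0 else 1)"
  shows "run_spec w c (Post d)"
  using assms unfolding run_spec.simps by blast

lemma zigzag_snoc:
  "zigzag d k [] 0 @ [(\<not> d, False)] = zigzag d (Suc k) [] 0"
  "zigzag d k bs 0 @ [(d, b)] = zigzag d k (bs @ [b]) 0"
  "zigzag d k bs j @ [(\<not> d, False)] = zigzag d k bs (Suc j)"
  by (simp_all add: zigzag_def replicate_append_same)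

lemma run_imp_spec: "run zigzag_edges Start w c q \<Longrightarrow> run_spec w c q"
proof (induction rule: run.induct)
  case (snoc w c p x h q)
  obtain e b where x: "x = (e, b)" by (cases x)
  from snoc.hyps(2)[unfolded x] show ?case
  proof cases
    case (start_pre d)
    then show ?thesis using x snoc.IH
      by (auto simp: zigzag_def intro!: exI[of _ 1])
  next
    case (pre_pre d)
    then obtain k where "w = zigzag d k [] 0" "c = - int k" using snoc.IH by auto
    moreover from this have "w @ [x] = zigzag d (Suc k) [] 0"
      using x pre_pre zigzag_snoc(1)[of d k] by simp
    ultimately show ?thesis using pre_pre by (auto intro!: exI[of _ "Suc k"])
  next
    case start_mid
    then show ?thesis using x snoc.IH
      by (auto simp: zigzag_def intro!: exI[of _ 0] exI[of _ "[b]"])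
  next
    case pre_mid
    then obtain k where "0 < k" "w = zigzag e k [] 0" "c = - int k" using snoc.IH by auto
    then show ?thesis using x pre_mid
      by (auto simp: zigzag_snoc(2) intro!: exI[of _ k] exI[of _ "[True]"])
  next
    case (mid_mid b')
    then obtain k bs where "w = zigzag e k bs 0" "bs \<noteq> []" "0 < k \<longrightarrow> hd bs" "- int k \<le> c"
      "c \<le> int (length bs) - int k - (if e then 0 else 1)"
      using snoc.IH by auto
    then show ?thesis using x mid_mid
      by (auto simp: zigzag_snoc(2) intro!: exI[of _ k] exI[of _ "bs @ [b]"])
  next
    case (mid_post d)
    then obtain k bs where "w = zigzag d k bs 0" "bs \<noteq> []" "0 < k \<longrightarrow> hd bs" "last bs" "- int k \<le> c"
      "c \<le> int (length bs) - int k - (if d then 0 else 1)"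
      using snoc.IH by auto
    moreover from this have "w @ [x] = zigzag d k bs 1"
      using x mid_post zigzag_snoc(3)[of d k bs 0] by simp
    ultimately have "run_spec (w @ [x]) (c - 1) (Post d)"
      by (intro run_spec_PostI[of _ d k bs 1]) auto
    then show ?thesis using mid_post by simp
  next
    case (post_post d)
    then obtain k bs j where "w = zigzag d k bs j" "bs \<noteq> []" "0 < k \<longrightarrow> hd bs" "last bs" "0 < j"
      "- int k - int j \<le> c"
      "c \<le> int (length bs) - int k - int j - (if d then 0 else 1)"
      using snoc.IH by auto
    moreover from this have "w @ [x] = zigzag d k bs (Suc j)"
      using x post_post zigzag_snoc(3)[of d k bs j] by simp
    ultimately have "run_spec (w @ [x]) (c - 1) (Post d)"
      by (intro run_spec_PostI[of _ d k bs "Suc j"]) auto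
    then show ?thesis using post_post by simp
  qed
qed simp

section \<open>Runs that realize the normal forms\<close>

lemma run_Pre: "0 < k \<Longrightarrow> run zigzag_edges Start (zigzag d k [] 0) (- int k) (Pre d)"
proof (induction k)
  case (Suc k)
  \<comment> \<open>The first outer step leaves \<open>Start\<close>; later ones loop at
    \<open>Pre d\<close>.\<close>
  have e: "(if k = 0 then Start else Pre d, (\<not> d, False), - 1, Pre d) \<in> zigzag_edges"
    by (auto intro: zigzag_edges.intros)
  have "run zigzag_edges Start (zigzag d k [] 0) (- int k) (if k = 0 then Start else Pre d)"
    using Suc.IH by (auto simp: zigzag_def intro: run.Nil)
  from run.snoc[OF this e] show ?case by (simp add: zigzag_snoc(1) algebra_simps)
qed simp

text \<open>Every counter value in the interval of \<open>run_spec\<close> is attained, by choosing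
  the increments backwards from the last step.\<close>

lemma run_Mid:
  assumes "bs \<noteq> []" "0 < k \<longrightarrow> hd bs" "- int k \<le> c"
    "c \<le> int (length bs) - int k - (if d then 0 else 1)"
  shows "run zigzag_edges Start (zigzag d k bs 0) c (Mid d (last bs))"
  using assms
proof (induction bs arbitrary: c rule: rev_nonempty_induct)
  case (single b)
  define p where "p = (if k = 0 then Start else Pre d)"
  have "run zigzag_edges Start (zigzag d k [] 0) (- int k) p"
    using run_Pre[of k d] by (auto simp: p_def zigzag_def intro: run.Nil)
  moreover have "(p, (d, b), c + int k, Mid d b) \<in> zigzag_edges"
  proof -
    have "c + int k = 0 \<or> c + int k = 1 \<and> d" using single by (auto split: if_splits)
    then show ?thesis
      using single.prems(1) unfolding p_def by (cases "k = 0") (auto intro: zigzag_edges.intros)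
  qed
  ultimately have "run zigzag_edges Start (zigzag d k [] 0 @ [(d, b)]) (- int k + (c + int k)) (Mid d b)"
    by (rule run.snoc)
  then show ?case by (simp add: zigzag_snoc(2))
next
  case (snoc b bs)
  \<comment> \<open>The last step counts up unless \<open>c\<close> is already the minimum
    \<open>- int k\<close>; either way \<open>c - h\<close> stays in the interval for
    \<open>bs\<close>.\<close>
  define h where "h = (if c = - int k then 0 else 1 :: int)"
  have "run zigzag_edges Start (zigzag d k bs 0) (c - h) (Mid d (last bs))"
    using snoc by (intro snoc.IH) (auto simp: h_def)
  moreover have "(Mid d (last bs), (d, b), h, Mid d b) \<in> zigzag_edges"
    by (auto simp: h_def intro: zigzag_edges.intros)
  ultimately have "run zigzag_edges Start (zigzag d k bs 0 @ [(d, b)]) (c - h + h) (Mid d b)"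
    by (rule run.snoc)
  then show ?case by (simp add: zigzag_snoc(2))
qed

lemma run_Post:
  assumes "run zigzag_edges Start (zigzag d k bs 0) c (Mid d True)"
  shows "run zigzag_edges Start (zigzag d k bs (Suc j)) (c - int (Suc j)) (Post d)"
proof (induction j)
  case 0
  from run.snoc[OF assms zigzag_edges.mid_post] show ?case by (simp add: zigzag_snoc(3))
next
  case (Suc j)
  from run.snoc[OF Suc zigzag_edges.post_post] show ?case by (simp add: zigzag_snoc(3) algebra_simps)
qed

lemma normal_words_eq_run:
  "normal_words = {w. \<exists>q\<in>zigzag_accept. run zigzag_edges Start w 0 q}"
proof (intro equalityI subsetI)
  fix w assume "w \<in> normal_words"
  then obtain d k bs j where w: "w = zigzag d k bs j" and a: "admissible d k bs j"
    by (auto simp: normal_words_def)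
  show "w \<in> {w. \<exists>q\<in>zigzag_accept. run zigzag_edges Start w 0 q}"
  proof (cases "bs = []")
    case True
    then have "w = []" using a w by (auto simp: admissible_def zigzag_def)
    then show ?thesis by (auto simp: zigzag_accept_def intro: run.Nil)
  next
    case False
    \<comment> \<open>The middle run ends with counter \<open>j\<close>, exactly what the closing
      run uses up. This value is in range by the length condition of
      \<open>admissible\<close>.\<close>
    have mid: "run zigzag_edges Start (zigzag d k bs 0) (int j) (Mid d (last bs))"
      using a False by (intro run_Mid) (auto simp: admissible_def split: if_splits)
    show ?thesis
    proof (cases j)
      case 0
      then show ?thesis using mid w by (auto simp: zigzag_accept_def)
    next
      case (Suc j')
      then have "last bs" using a by (simp add: admissible_def)
      then show ?thesis
        using run_Post[of d k bs "int j" j'] mid Suc w by (auto simp: zigzag_accept_def)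
    qed
  qed
next
  fix w assume "w \<in> {w. \<exists>q\<in>zigzag_accept. run zigzag_edges Start w 0 q}"
  then obtain q where "q \<in> zigzag_accept" "run_spec w 0 q"
    using run_imp_spec by blast
  then consider "w = []" | d b where "run_spec w 0 (Mid d b)" | d where "run_spec w 0 (Post d)"
    by (auto simp: zigzag_accept_def simp del: run_spec.simps(2-4))
  then have "\<exists>d k bs j. w = zigzag d k bs j \<and> admissible d k bs j"
  proof cases
    case 1
    then show ?thesis
      by (intro exI[of _ True] exI[of _ 0] exI[of _ "[]"]) (simp add: zigzag_def admissible_def)
  next
    case (2 d b)
    \<comment> \<open>At counter value \<open>0\<close> the upper bound in \<open>run_spec\<close>
      becomes the length condition of \<open>admissible\<close>.\<close>
    then obtain k bs where "w = zigzag d k bs 0" "0 < k \<longrightarrow> hd bs"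
      "0 \<le> int (length bs) - int k - (if d then 0 else 1)" by auto
    then show ?thesis
      by (intro exI[of _ d] exI[of _ k] exI[of _ bs] exI[of _ 0])
        (auto simp: admissible_def split: if_splits)
  next
    case (3 d)
    then obtain k bs j where "w = zigzag d k bs j" "0 < k \<longrightarrow> hd bs" "last bs"
      "0 \<le> int (length bs) - int k - int j - (if d then 0 else 1)" by auto
    then show ?thesis
      by (intro exI[of _ d] exI[of _ k] exI[of _ bs] exI[of _ j])
        (auto simp: admissible_def split: if_splits)
  qed
  then show "w \<in> normal_words" by (auto simp: normal_words_def)
qed


section \<open>Geodesics\<close>

text \<open>A competing word lifts to a list of steps with the same state, so
  \<open>zigzag_shortest\<close> bounds its length.\<close>

lemma geodesic_word_normal:
  assumes "w \<in> normal_words"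
  shows "geodesic_word L2 L2_gens (map step_letter w)"
proof -
  have "length w \<le> length v"
    if v: "v \<in> lists (range step_letter)"
      "word_value L2 v = word_value L2 (map step_letter w)" for v
  proof -
    obtain v' where "v = map step_letter v'"
      using v(1) unfolding lists_image lists_UNIV by blast
    then show ?thesis
      using v(2) assms zigzag_shortest
      by (fastforce simp: word_value_eq_iff normal_words_def)
  qed
  then have "word_length L2 L2_gens (word_value L2 (map step_letter w)) = length w"
    unfolding word_length_def range_step_letter[symmetric]
    by (intro Least_equality bexI[of _ "map step_letter w"]) auto
  then show ?thesis
    by (auto simp: geodesic_word_def simp flip: range_step_letter)
qed

theorem theorem24:
  shows "\<exists>L. (\<forall>w\<in>L. geodesic_word L2 L2_gens w) \<and>
             (\<forall>g\<in>carrier L2. \<exists>!w. w \<in> L \<and> word_value L2 w = g) \<and>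
             accepted_by_one_counter (sym_alphabet L2 L2_gens) L"
proof (intro exI[of _ "map step_letter ` normal_words"] conjI ballI)
  show "geodesic_word L2 L2_gens w" if "w \<in> map step_letter ` normal_words" for w
    using that geodesic_word_normal by auto
  show "accepted_by_one_counter (sym_alphabet L2 L2_gens) (map step_letter ` normal_words)"
    unfolding normal_words_eq_run range_step_letter[symmetric]
    by (rule accepted_by_one_counter_run[OF finite_zigzag_edges])
  fix g assume "g \<in> carrier L2"
  then obtain u where g: "g = lamp_class u"
    by (auto simp: L2_def carrier_presented_group)
  obtain w where w: "w \<in> normal_words" "steps_state w = gword_state u"
    using normal_words_exists[OF finite_gword_state[of u], of "snd (gword_state u)"] by auto
  show "\<exists>!w. w \<in> map step_letter ` normal_words \<and> word_value L2 w = g"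
  proof (rule ex1I[of _ "map step_letter w"])
    show "map step_letter w \<in> map step_letter ` normal_words \<and>
        word_value L2 (map step_letter w) = g"
      using w g by (simp add: word_value_eq_lamp_class_iff)
    fix v assume "v \<in> map step_letter ` normal_words \<and> word_value L2 v = g"
    then obtain v' where "v = map step_letter v'" "v' \<in> normal_words"
      "steps_state v' = gword_state u"
      using g by (auto simp: word_value_eq_lamp_class_iff)
    then show "v = map step_letter w"
      using w inj_on_steps_state by (metis inj_onD)
  qed
qed

end
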